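(* Let $G$ and $H$ be equivalent locally compact Hausdorff groupoids with open range and source maps. Then: (a) $G$ is proper if and only if $H$ is proper. (b) $G$ is Cartan if and only if $H$ is Cartan.
   Context: Groupoids are topological groupoids, not assumed second countable and not assumed to have Haar systems. $G^{(0)}$ is the unit space of $G$, and $r,s:G\to G^{(0)}$ are the range and source maps. Actions: a left action of $G$ on a space $P$ consists of a continuous moment map $r_P:P\to G^{(0)}$ and a continuous map $(\gamma,p)\mapsto\gamma\cdot p$ from $G*P=\{(\gamma,p): s(\gamma)=r_P(p)\}$ to $P$ with $r_P(\gamma\cdot p)=r(\gamma)$, $r_P(p)\cdot p=p$ and $\gamma\cdot(\eta\cdot p)=(\gamma\eta)\cdot p$ for composable $\gamma,\eta$. The action is free if $\gamma\cdot p=p$ only when $\gamma=r_P(p)$. It is proper if the map $\Theta:G*P\to P\times P$, $\Theta(\gamma,p)=(\gamma\cdot p,p)$, is proper (preimages of compact sets are compact). Right actions are defined similarly, with moment map $s_P$. Equivalence: $G$ and $H$ are equivalent if there is a $(G,H)$-equivalence, i.e. a locally compact Hausdorff space $Z$ such that: (E1) $Z$ is a free and proper left $G$-space; (E2) $Z$ is a free and proper right $H$-space; (E3) the two actions commute; (E4) the moment map $r_Z:Z\to G^{(0)}$ is open and induces a homeomorphism $Z/H\to G^{(0)}$; (E5) the moment map $s_Z:Z\to H^{(0)}$ is open and induces a homeomorphism $G\backslash Z\to H^{(0)}$. A groupoid $G$ acts on $G^{(0)}$ by $\gamma\cdot s(\gamma)=r(\gamma)$. $G$ is proper if this action is proper,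 i.e. $\gamma\mapsto(r(\gamma),s(\gamma))$ is a proper map $G\to G^{(0)}\times G^{(0)}$. $G$ is Cartan if every point of $G^{(0)}$ has a compact neighborhood $K$ such that $\Theta^{-1}(K\times K)$ is compact for this action, i.e. such that $\{\gamma\in G: r(\gamma)\in K,\ s(\gamma)\in K\}$ is compact. *)

theory Defs
  imports "HOL-Analysis.Analysis"
begin

section \<open>Topological groupoids\<close>

text \<open>The arrows form the underlying set of \<open>arrows G\<close>, and units are themselves arrows, so
  that the unit space is a subspace of the space of arrows. The product \<open>mul G x y\<close> is meaningful
  only for \<open>src G x = rng G y\<close>.\<close>

record 'a groupoid =
  arrows :: "'a topology"
  rng :: "'a \<Rightarrow> 'a"
  src :: "'a \<Rightarrow> 'a"
  mul :: "'a \<Rightarrow> 'a \<Rightarrow> 'a"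
  inv_arrow :: "'a \<Rightarrow> 'a"

definition units :: "'a groupoid \<Rightarrow> 'a topology" where
  "units G = subtopology (arrows G) (rng G ` topspace (arrows G))"

definition composable :: "'a groupoid \<Rightarrow> ('a \<times> 'a) topology" where
  "composable G = subtopology (prod_topology (arrows G) (arrows G)) {(x, y). src G x = rng G y}"

definition algebraic_groupoid :: "'a groupoid \<Rightarrow> bool" where
  "algebraic_groupoid G \<longleftrightarrow> (let A = topspace (arrows G) in
     (\<forall>x\<in>A. rng G x \<in> A \<and> src G x \<in> A \<and>
        rng G (rng G x) = rng G x \<and> src G (rng G x) = rng G x \<and>
        rng G (src G x) = src G x \<and> src G (src G x) = src G x) \<and>
     (\<forall>x\<in>A. \<forall>y\<in>A. src G x = rng G y \<longrightarrow>
        mul G x y \<in> A \<and> rng G (mul G x y) = rng G x \<and> src G (mul G x y) = src G y) \<and>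
     (\<forall>x\<in>A. \<forall>y\<in>A. \<forall>z\<in>A. src G x = rng G y \<longrightarrow> src G y = rng G z \<longrightarrow>
        mul G (mul G x y) z = mul G x (mul G y z)) \<and>
     (\<forall>x\<in>A. mul G (rng G x) x = x \<and> mul G x (src G x) = x) \<and>
     (\<forall>x\<in>A. inv_arrow G x \<in> A \<and> rng G (inv_arrow G x) = src G x \<and> src G (inv_arrow G x) = rng G x \<and>
        mul G x (inv_arrow G x) = rng G x \<and> mul G (inv_arrow G x) x = src G x))"

definition topological_groupoid :: "'a groupoid \<Rightarrow> bool" where
  "topological_groupoid G \<longleftrightarrow>
     algebraic_groupoid G \<and>
     continuous_map (composable G) (arrows G) (\<lambda>(x, y). mul G x y) \<and>
     continuous_map (arrows G) (arrows G) (inv_arrow G)"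

definition locally_compact_Hausdorff_groupoid :: "'a groupoid \<Rightarrow> bool" where
  "locally_compact_Hausdorff_groupoid G \<longleftrightarrow>
     topological_groupoid G \<and> locally_compact_space (arrows G) \<and> Hausdorff_space (arrows G)"

definition open_range_source :: "'a groupoid \<Rightarrow> bool" where
  "open_range_source G \<longleftrightarrow>
     open_map (arrows G) (units G) (rng G) \<and> open_map (arrows G) (units G) (src G)"

section \<open>Actions\<close>

text \<open>Preimages of compact sets are compact. The library's \<open>proper_map\<close> is instead defined by
  closedness together with compact fibres.\<close>

definition compact_preimages :: "'a topology \<Rightarrow> 'b topology \<Rightarrow> ('a \<Rightarrow> 'b) \<Rightarrow> bool" where
  "compact_preimages X Y f \<longleftrightarrow>
     (\<forall>K. compactin Y K \<longrightarrow> compactin X {x \<in> topspace X. f x \<in> K})"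

definition left_fibre_product :: "'a groupoid \<Rightarrow> 'p topology \<Rightarrow> ('p \<Rightarrow> 'a) \<Rightarrow> ('a \<times> 'p) topology" where
  "left_fibre_product G P rP = subtopology (prod_topology (arrows G) P) {(g, p). src G g = rP p}"

definition right_fibre_product :: "'a groupoid \<Rightarrow> 'p topology \<Rightarrow> ('p \<Rightarrow> 'a) \<Rightarrow> ('p \<times> 'a) topology" where
  "right_fibre_product H P sP = subtopology (prod_topology P (arrows H)) {(p, h). sP p = rng H h}"

definition left_action ::
    "'a groupoid \<Rightarrow> 'p topology \<Rightarrow> ('p \<Rightarrow> 'a) \<Rightarrow> ('a \<Rightarrow> 'p \<Rightarrow> 'p) \<Rightarrow> bool" where
  "left_action G P rP act \<longleftrightarrow>
     continuous_map P (units G) rP \<and>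
     continuous_map (left_fibre_product G P rP) P (\<lambda>(g, p). act g p) \<and>
     (\<forall>g\<in>topspace (arrows G). \<forall>p\<in>topspace P. src G g = rP p \<longrightarrow> rP (act g p) = rng G g) \<and>
     (\<forall>p\<in>topspace P. act (rP p) p = p) \<and>
     (\<forall>g\<in>topspace (arrows G). \<forall>k\<in>topspace (arrows G). \<forall>p\<in>topspace P.
        src G g = rng G k \<longrightarrow> src G k = rP p \<longrightarrow> act g (act k p) = act (mul G g k) p)"

definition right_action ::
    "'a groupoid \<Rightarrow> 'p topology \<Rightarrow> ('p \<Rightarrow> 'a) \<Rightarrow> ('p \<Rightarrow> 'a \<Rightarrow> 'p) \<Rightarrow> bool" where
  "right_action H P sP act \<longleftrightarrow>
     continuous_map P (units H) sP \<and>
     continuous_map (right_fibre_product H P sP) P (\<lambda>(p, h). act p h) \<and>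
     (\<forall>p\<in>topspace P. \<forall>h\<in>topspace (arrows H). sP p = rng H h \<longrightarrow> sP (act p h) = src H h) \<and>
     (\<forall>p\<in>topspace P. act p (sP p) = p) \<and>
     (\<forall>p\<in>topspace P. \<forall>h\<in>topspace (arrows H). \<forall>k\<in>topspace (arrows H).
        sP p = rng H h \<longrightarrow> src H h = rng H k \<longrightarrow> act (act p h) k = act p (mul H h k))"

definition free_left_action ::
    "'a groupoid \<Rightarrow> 'p topology \<Rightarrow> ('p \<Rightarrow> 'a) \<Rightarrow> ('a \<Rightarrow> 'p \<Rightarrow> 'p) \<Rightarrow> bool" where
  "free_left_action G P rP act \<longleftrightarrow>
     (\<forall>(g, p)\<in>topspace (left_fibre_product G P rP). act g p = p \<longrightarrow> g = rP p)"

definition free_right_action ::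
    "'a groupoid \<Rightarrow> 'p topology \<Rightarrow> ('p \<Rightarrow> 'a) \<Rightarrow> ('p \<Rightarrow> 'a \<Rightarrow> 'p) \<Rightarrow> bool" where
  "free_right_action H P sP act \<longleftrightarrow>
     (\<forall>(p, h)\<in>topspace (right_fibre_product H P sP). act p h = p \<longrightarrow> h = sP p)"

definition proper_left_action ::
    "'a groupoid \<Rightarrow> 'p topology \<Rightarrow> ('p \<Rightarrow> 'a) \<Rightarrow> ('a \<Rightarrow> 'p \<Rightarrow> 'p) \<Rightarrow> bool" where
  "proper_left_action G P rP act \<longleftrightarrow>
     compact_preimages (left_fibre_product G P rP) (prod_topology P P) (\<lambda>(g, p). (act g p, p))"

definition proper_right_action ::
    "'a groupoid \<Rightarrow> 'p topology \<Rightarrow> ('p \<Rightarrow> 'a) \<Rightarrow> ('p \<Rightarrow> 'a \<Rightarrow> 'p) \<Rightarrow> bool" where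
  "proper_right_action H P sP act \<longleftrightarrow>
     compact_preimages (right_fibre_product H P sP) (prod_topology P P) (\<lambda>(p, h). (act p h, p))"

text \<open>Every point has a compact neighbourhood \<open>K\<close> such that the preimage of \<open>K \<times> K\<close> under
  \<open>(g, p) \<mapsto> (g \<cdot> p, p)\<close> is compact.\<close>

definition Cartan_left_action ::
    "'a groupoid \<Rightarrow> 'p topology \<Rightarrow> ('p \<Rightarrow> 'a) \<Rightarrow> ('a \<Rightarrow> 'p \<Rightarrow> 'p) \<Rightarrow> bool" where
  "Cartan_left_action G P rP act \<longleftrightarrow>
     (\<forall>u\<in>topspace P. \<exists>U K. openin P U \<and> u \<in> U \<and> U \<subseteq> K \<and> compactin P K \<and>
        compactin (left_fibre_product G P rP)
          {(g, p) \<in> topspace (left_fibre_product G P rP). (act g p, p) \<in> K \<times> K})"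

section \<open>Proper and Cartan groupoids\<close>

text \<open>\<open>G\<close> acts on its unit space with the identity as moment map, by \<open>g \<cdot> src g = rng g\<close>.\<close>

definition unit_action :: "'a groupoid \<Rightarrow> 'a \<Rightarrow> 'a \<Rightarrow> 'a" where
  "unit_action G g u = rng G g"

definition proper_groupoid :: "'a groupoid \<Rightarrow> bool" where
  "proper_groupoid G \<longleftrightarrow> proper_left_action G (units G) id (unit_action G)"

definition Cartan_groupoid :: "'a groupoid \<Rightarrow> bool" where
  "Cartan_groupoid G \<longleftrightarrow> Cartan_left_action G (units G) id (unit_action G)"

section \<open>Equivalence of groupoids\<close>

definition quotient_topology :: "'a topology \<Rightarrow> ('a \<Rightarrow> 'b) \<Rightarrow> 'b topology" where
  "quotient_topology X q =
     topology (\<lambda>U. U \<subseteq> q ` topspace X \<and> openin X {x \<in> topspace X. q x \<in> U})"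

definition left_orbit ::
    "'a groupoid \<Rightarrow> ('p \<Rightarrow> 'a) \<Rightarrow> ('a \<Rightarrow> 'p \<Rightarrow> 'p) \<Rightarrow> 'p \<Rightarrow> 'p set" where
  "left_orbit G rP act p = {act g p |g. g \<in> topspace (arrows G) \<and> src G g = rP p}"

definition right_orbit ::
    "'a groupoid \<Rightarrow> ('p \<Rightarrow> 'a) \<Rightarrow> ('p \<Rightarrow> 'a \<Rightarrow> 'p) \<Rightarrow> 'p \<Rightarrow> 'p set" where
  "right_orbit H sP act p = {act p h |h. h \<in> topspace (arrows H) \<and> sP p = rng H h}"

text \<open>\<open>f\<close> factors through the quotient map \<open>q\<close> by a homeomorphism onto \<open>Y\<close>.\<close>

definition induces_homeomorphism ::
    "'a topology \<Rightarrow> ('a \<Rightarrow> 'b) \<Rightarrow> 'c topology \<Rightarrow> ('a \<Rightarrow> 'c) \<Rightarrow> bool" where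
  "induces_homeomorphism X q Y f \<longleftrightarrow>
     (\<exists>f'. (\<forall>x\<in>topspace X. f' (q x) = f x) \<and> homeomorphic_map (quotient_topology X q) Y f')"

text \<open>The first two conjuncts say that both sides of \<open>(g \<cdot> z) \<cdot> h = g \<cdot> (z \<cdot> h)\<close> are defined.
  In an equivalence they also follow from the moment maps being constant on the orbits of
  the opposite action.\<close>

definition commuting_actions ::
    "'a groupoid \<Rightarrow> 'b groupoid \<Rightarrow> 'z topology \<Rightarrow> ('z \<Rightarrow> 'a) \<Rightarrow> ('a \<Rightarrow> 'z \<Rightarrow> 'z) \<Rightarrow>
      ('z \<Rightarrow> 'b) \<Rightarrow> ('z \<Rightarrow> 'b \<Rightarrow> 'z) \<Rightarrow> bool" where
  "commuting_actions G H Z rZ lact sZ ract \<longleftrightarrow>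
     (\<forall>g\<in>topspace (arrows G). \<forall>z\<in>topspace Z. src G g = rZ z \<longrightarrow> sZ (lact g z) = sZ z) \<and>
     (\<forall>z\<in>topspace Z. \<forall>h\<in>topspace (arrows H). sZ z = rng H h \<longrightarrow> rZ (ract z h) = rZ z) \<and>
     (\<forall>g\<in>topspace (arrows G). \<forall>z\<in>topspace Z. \<forall>h\<in>topspace (arrows H).
        src G g = rZ z \<longrightarrow> sZ z = rng H h \<longrightarrow> ract (lact g z) h = lact g (ract z h))"

definition groupoid_equivalence ::
    "'a groupoid \<Rightarrow> 'b groupoid \<Rightarrow> 'z topology \<Rightarrow> ('z \<Rightarrow> 'a) \<Rightarrow> ('a \<Rightarrow> 'z \<Rightarrow> 'z) \<Rightarrow>
      ('z \<Rightarrow> 'b) \<Rightarrow> ('z \<Rightarrow> 'b \<Rightarrow> 'z) \<Rightarrow> bool" where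
  "groupoid_equivalence G H Z rZ lact sZ ract \<longleftrightarrow>
     locally_compact_space Z \<and> Hausdorff_space Z \<and>
     left_action G Z rZ lact \<and> free_left_action G Z rZ lact \<and> proper_left_action G Z rZ lact \<and>
     right_action H Z sZ ract \<and> free_right_action H Z sZ ract \<and> proper_right_action H Z sZ ract \<and>
     commuting_actions G H Z rZ lact sZ ract \<and>
     open_map Z (units G) rZ \<and>
     induces_homeomorphism Z (right_orbit H sZ ract) (units G) rZ \<and>
     open_map Z (units H) sZ \<and>
     induces_homeomorphism Z (left_orbit G rZ lact) (units H) sZ"

text \<open>HOL cannot quantify over the type carrying \<open>Z\<close> inside a formula, so that type is a
  parameter. As a hypothesis with \<open>'z\<close> a free type variable, this covers every \<open>Z\<close>.\<close>

definition equivalent_groupoids :: "'z itself \<Rightarrow> 'a groupoid \<Rightarrow> 'b groupoid \<Rightarrow> bool" where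
  "equivalent_groupoids (_ :: 'z itself) G H \<longleftrightarrow>
     (\<exists>(Z :: 'z topology) rZ lact sZ ract. groupoid_equivalence G H Z rZ lact sZ ract)"

section \<open>Consistency of the definitions\<close>

lemma openin_quotient_topology:
  "openin (quotient_topology X q) U \<longleftrightarrow>
     U \<subseteq> q ` topspace X \<and> openin X {x \<in> topspace X. q x \<in> U}"
proof -
  have "istopology (\<lambda>U. U \<subseteq> q ` topspace X \<and> openin X {x \<in> topspace X. q x \<in> U})"
    unfolding istopology_def
  proof (intro conjI allI impI)
    fix S T
    assume S: "S \<subseteq> q ` topspace X \<and> openin X {x \<in> topspace X. q x \<in> S}"
      and T: "T \<subseteq> q ` topspace X \<and> openin X {x \<in> topspace X. q x \<in> T}"
    have "{x \<in> topspace X. q x \<in> S \<inter> T} =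
        {x \<in> topspace X. q x \<in> S} \<inter> {x \<in> topspace X. q x \<in> T}" by auto
    then show "openin X {x \<in> topspace X. q x \<in> S \<inter> T}" using S T by (simp add: openin_Int)
    show "S \<inter> T \<subseteq> q ` topspace X" using S by auto
  next
    fix \<K>
    assume K: "\<forall>K\<in>\<K>. K \<subseteq> q ` topspace X \<and> openin X {x \<in> topspace X. q x \<in> K}"
    have "{x \<in> topspace X. q x \<in> \<Union>\<K>} = (\<Union>K\<in>\<K>. {x \<in> topspace X. q x \<in> K})" by auto
    then show "openin X {x \<in> topspace X. q x \<in> \<Union>\<K>}" using K by auto
    show "\<Union>\<K> \<subseteq> q ` topspace X" using K by auto
  qed
  then show ?thesis by (simp add: quotient_topology_def)
qed

lemma quotient_map_quotient_topology: "quotient_map X (quotient_topology X q) q"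
proof -
  have "{x \<in> topspace X. q x \<in> q ` topspace X} = topspace X" by auto
  then have "openin (quotient_topology X q) (q ` topspace X)"
    by (simp add: openin_quotient_topology)
  moreover have "topspace (quotient_topology X q) \<subseteq> q ` topspace X"
    using openin_topspace[of "quotient_topology X q"] unfolding openin_quotient_topology by (rule conjunct1)
  ultimately have "topspace (quotient_topology X q) = q ` topspace X"
    using openin_subset by blast
  then show ?thesis by (auto simp: quotient_map_def openin_quotient_topology)
qed

lemma continuous_map_rng_src:
  assumes "topological_groupoid G"
  shows "continuous_map (arrows G) (units G) (rng G)" "continuous_map (arrows G) (units G) (src G)"
proof -
  let ?A = "arrows G"
  have alg: "algebraic_groupoid G"
    and cm: "continuous_map (composable G) ?A (\<lambda>(x, y). mul G x y)"
    and ci: "continuous_map ?A ?A (inv_arrow G)"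
    using assms by (auto simp: topological_groupoid_def)
  have src_unit: "src G x \<in> rng G ` topspace ?A" if "x \<in> topspace ?A" for x
  proof (rule image_eqI)
    show "src G x = rng G (src G x)" "src G x \<in> topspace ?A"
      using alg that by (simp_all add: algebraic_groupoid_def Let_def)
  qed
  have "continuous_map ?A (composable G) (\<lambda>x. (x, inv_arrow G x))"
    unfolding composable_def using alg ci
    by (intro continuous_map_into_subtopology continuous_map_pairedI)
       (auto simp: algebraic_groupoid_def Let_def)
  from continuous_map_compose[OF this cm] have "continuous_map ?A ?A (\<lambda>x. mul G x (inv_arrow G x))"
    by (simp add: o_def)
  then have "continuous_map ?A ?A (rng G)"
    by (rule continuous_map_eq) (use alg in \<open>auto simp: algebraic_groupoid_def Let_def\<close>)
  then show "continuous_map ?A (units G) (rng G)"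
    unfolding units_def by (intro continuous_map_into_subtopology) auto
  have "continuous_map ?A (composable G) (\<lambda>x. (inv_arrow G x, x))"
    unfolding composable_def using alg ci
    by (intro continuous_map_into_subtopology continuous_map_pairedI)
       (auto simp: algebraic_groupoid_def Let_def)
  from continuous_map_compose[OF this cm] have "continuous_map ?A ?A (\<lambda>x. mul G (inv_arrow G x) x)"
    by (simp add: o_def)
  then have "continuous_map ?A ?A (src G)"
    by (rule continuous_map_eq) (use alg in \<open>auto simp: algebraic_groupoid_def Let_def\<close>)
  then show "continuous_map ?A (units G) (src G)"
    unfolding units_def using src_unit by (intro continuous_map_into_subtopology) auto
qed

lemma unit_action_preimage_compact_iff:
  assumes "topological_groupoid G"
  shows "compactin (left_fibre_product G (units G) id)
           {x \<in> topspace (left_fibre_product G (units G) id).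
              (case x of (g, u) \<Rightarrow> (unit_action G g u, u)) \<in> K} \<longleftrightarrow>
         compactin (arrows G) {g \<in> topspace (arrows G). (rng G g, src G g) \<in> K}"
    (is "compactin ?F ?L \<longleftrightarrow> compactin _ ?R")
proof
  note c = continuous_map_rng_src[OF assms]
  have su: "src G g \<in> topspace (units G)" if "g \<in> topspace (arrows G)" for g
    using c(2) that by (auto simp: continuous_map_def)
  have top: "topspace ?F = {(g, u). g \<in> topspace (arrows G) \<and> u = src G g}"
    using su by (auto simp: left_fibre_product_def)
  have L: "?L = (\<lambda>g. (g, src G g)) ` ?R"
    unfolding top by (auto simp: unit_action_def)
  have R: "?R = fst ` ?L"
    unfolding L by (simp add: image_image)
  have "continuous_map ?F (arrows G) fst"
    unfolding left_fibre_product_def by (simp add: continuous_map_fst continuous_map_from_subtopology)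
  then show "compactin (arrows G) ?R" if "compactin ?F ?L"
    unfolding R by (rule image_compactin[OF that])
  have "continuous_map (arrows G) ?F (\<lambda>g. (g, src G g))"
    unfolding left_fibre_product_def using c(2)
    by (intro continuous_map_into_subtopology continuous_map_pairedI) auto
  then show "compactin ?F ?L" if "compactin (arrows G) ?R"
    unfolding L by (rule image_compactin[OF that])
qed

lemma proper_groupoid_iff:
  assumes "topological_groupoid G"
  shows "proper_groupoid G \<longleftrightarrow>
    compact_preimages (arrows G) (prod_topology (units G) (units G)) (\<lambda>g. (rng G g, src G g))"
  unfolding proper_groupoid_def proper_left_action_def compact_preimages_def
    unit_action_preimage_compact_iff[OF assms] ..

lemma Cartan_groupoid_iff:
  assumes "topological_groupoid G"
  shows "Cartan_groupoid G \<longleftrightarrow>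
    (\<forall>u\<in>topspace (units G). \<exists>U K. openin (units G) U \<and> u \<in> U \<and> U \<subseteq> K \<and> compactin (units G) K \<and>
       compactin (arrows G) {g \<in> topspace (arrows G). rng G g \<in> K \<and> src G g \<in> K})"
proof -
  have "{(g, p) \<in> topspace (left_fibre_product G (units G) id). (unit_action G g p, p) \<in> K \<times> K} =
      {x \<in> topspace (left_fibre_product G (units G) id).
         (case x of (g, u) \<Rightarrow> (unit_action G g u, u)) \<in> K \<times> K}" for K
    by auto
  moreover have "{g \<in> topspace (arrows G). rng G g \<in> K \<and> src G g \<in> K} =
      {g \<in> topspace (arrows G). (rng G g, src G g) \<in> K \<times> K}" for K
    by auto
  ultimately show ?thesis
    unfolding Cartan_groupoid_def Cartan_left_action_def
    by (simp only: unit_action_preimage_compact_iff[OF assms])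
qed

lemma left_action_unit_action:
  assumes "topological_groupoid G"
  shows "left_action G (units G) id (unit_action G)"
proof -
  note c = continuous_map_rng_src[OF assms]
  have "algebraic_groupoid G" using assms by (simp add: topological_groupoid_def)
  moreover have "continuous_map (left_fibre_product G (units G) id) (arrows G) fst"
    unfolding left_fibre_product_def by (simp add: continuous_map_fst continuous_map_from_subtopology)
  from continuous_map_compose[OF this c(1)]
  have "continuous_map (left_fibre_product G (units G) id) (units G) (\<lambda>(g, p). unit_action G g p)"
    by (simp add: o_def unit_action_def case_prod_unfold)
  ultimately show ?thesis
    by (auto simp: left_action_def unit_action_def algebraic_groupoid_def Let_def units_def)
qed

end

theory Submission
  imports Defs
begin

text \<open>Let \<open>C\<close> be a compact subset of the equivalence \<open>Z\<close>. If \<open>r \<eta>\<close> and \<open>s \<eta>\<close> lie in \<open>s\<^sub>Z(C)\<close>, say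
  \<open>r \<eta> = s\<^sub>Z z\<close> and \<open>s \<eta> = s\<^sub>Z w\<close> with \<open>z, w \<in> C\<close>, then \<open>z \<eta>\<close> and \<open>w\<close> have the same image under
  \<open>s\<^sub>Z\<close>, so \<open>z \<eta> = \<gamma> w\<close> for some \<open>\<gamma>\<close> whose range and source lie in \<open>r\<^sub>Z(C)\<close>. If such \<open>\<gamma>\<close> form a
  compact set \<open>A\<close>, then \<open>z \<eta>\<close> lies in the compact set \<open>A C\<close>, and properness of the action of \<open>H\<close>
  confines \<open>\<eta>\<close> to a compact set. For properness of \<open>H\<close> take \<open>C\<close> with \<open>s\<^sub>Z(C)\<close> containing a given
  compact set, and for the Cartan property take \<open>C\<close> to be a small compact neighbourhood. The
  converse implications follow by exchanging the roles of the opposite groupoids.\<close>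

section \<open>Compactness and open maps\<close>

text \<open>Carries properness between left and right fibre products, which differ only by the order
  of the factors.\<close>

lemma compact_preimages_homeomorphic:
  assumes "homeomorphic_maps X' X h k" and "compact_preimages X Y f"
  shows "compact_preimages X' Y (f \<circ> h)"
  unfolding compact_preimages_def
proof (intro allI impI)
  fix K assume "compactin Y K"
  then have c: "compactin X {x \<in> topspace X. f x \<in> K}"
    using assms(2) by (simp add: compact_preimages_def)
  have "{x \<in> topspace X'. (f \<circ> h) x \<in> K} = k ` {x \<in> topspace X. f x \<in> K}"
  proof (intro equalityI subsetI)
    fix x assume "x \<in> {x \<in> topspace X'. (f \<circ> h) x \<in> K}"
    then have "h x \<in> {x \<in> topspace X. f x \<in> K}" "x = k (h x)"
      using assms(1) by (auto simp: homeomorphic_maps_def continuous_map_def)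
    then show "x \<in> k ` {x \<in> topspace X. f x \<in> K}" by blast
  next
    fix x assume "x \<in> k ` {x \<in> topspace X. f x \<in> K}"
    then show "x \<in> {x \<in> topspace X'. (f \<circ> h) x \<in> K}"
      using assms(1) by (auto simp: homeomorphic_maps_def continuous_map_def)
  qed
  moreover have "continuous_map X X' k"
    using assms(1) by (simp add: homeomorphic_maps_def)
  ultimately show "compactin X' {x \<in> topspace X'. (f \<circ> h) x \<in> K}"
    using image_compactin[OF c] by metis
qed

text \<open>Each point of \<open>X\<close> has an open neighbourhood \<open>U x\<close> inside a
  compact set \<open>C x\<close>. The images of the \<open>U x\<close> are open and cover
  \<open>K\<close>, so finitely many suffice, and the union of the corresponding \<open>C x\<close>
  is the required compact set.\<close>

lemma compact_lift_open_map:
  assumes lc: "locally_compact_space X" and f: "open_map X Y f"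
    and surj: "f ` topspace X = topspace Y" and K: "compactin Y K"
  obtains C where "compactin X C" "K \<subseteq> f ` C"
proof -
  have "\<forall>x\<in>topspace X. \<exists>U C. openin X U \<and> compactin X C \<and> x \<in> U \<and> U \<subseteq> C"
    using lc by (simp add: locally_compact_space_def)
  then obtain U C where UC: "\<And>x. x \<in> topspace X \<Longrightarrow> openin X (U x) \<and> compactin X (C x) \<and> x \<in> U x \<and> U x \<subseteq> C x"
    by metis
  let ?\<U> = "(\<lambda>x. f ` U x) ` topspace X"
  have "\<forall>V\<in>?\<U>. openin Y V"
    using UC f by (auto simp: open_map_def)
  moreover have "K \<subseteq> \<Union>?\<U>"
  proof
    fix y assume "y \<in> K"
    then obtain x where "x \<in> topspace X" "y = f x"
      using compactin_subset_topspace[OF K] surj by blast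
    then show "y \<in> \<Union>?\<U>" using UC by blast
  qed
  ultimately obtain \<F> where "finite \<F>" "\<F> \<subseteq> ?\<U>" "K \<subseteq> \<Union>\<F>"
    using K unfolding compactin_def by meson
  then obtain S where S: "finite S" "S \<subseteq> topspace X" "K \<subseteq> (\<Union>x\<in>S. f ` U x)"
    by (metis finite_subset_image)
  show thesis
  proof
    show "compactin X (\<Union>x\<in>S. C x)"
      using S UC by (intro compactin_Union) auto
    show "K \<subseteq> f ` (\<Union>x\<in>S. C x)"
      using S UC by blast
  qed
qed

section \<open>The opposite groupoid\<close>

text \<open>Reversing arrows turns right actions into left actions with the same moment map and the
  same underlying operation, so that no inverses have to be inserted into the actions.\<close>

definition opposite :: "'a groupoid \<Rightarrow> 'a groupoid" where
  "opposite G = \<lparr>arrows = arrows G, rng = src G, src = rng G,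
     mul = (\<lambda>x y. mul G y x), inv_arrow = inv_arrow G\<rparr>"

lemma opposite_simps [simp]:
  "arrows (opposite G) = arrows G" "rng (opposite G) = src G" "src (opposite G) = rng G"
  "mul (opposite G) x y = mul G y x" "inv_arrow (opposite G) = inv_arrow G"
  by (simp_all add: opposite_def)

lemma opposite_opposite [simp]: "opposite (opposite G) = G"
  by (simp add: opposite_def)

text \<open>\<open>units\<close> is built from \<open>rng\<close>, so for the opposite groupoid it
  is the image of \<open>src\<close>. The two images agree because every range and every source is
  fixed by both maps.\<close>

lemma units_opposite:
  assumes "algebraic_groupoid G"
  shows "units (opposite G) = units G"
proof -
  have "src G ` topspace (arrows G) = rng G ` topspace (arrows G)"
  proof (intro equalityI image_subsetI)
    fix x assume "x \<in> topspace (arrows G)"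
    with assms have "src G x = rng G (src G x)" "rng G x = src G (rng G x)"
      "src G x \<in> topspace (arrows G)" "rng G x \<in> topspace (arrows G)"
      by (simp_all add: algebraic_groupoid_def Let_def)
    then show "src G x \<in> rng G ` topspace (arrows G)" "rng G x \<in> src G ` topspace (arrows G)"
      by blast+
  qed
  then show ?thesis by (simp add: units_def)
qed

lemma algebraic_groupoid_opposite: "algebraic_groupoid G \<Longrightarrow> algebraic_groupoid (opposite G)"
  unfolding algebraic_groupoid_def Let_def by simp

lemma homeomorphic_maps_swap_fibre_product:
  "homeomorphic_maps (left_fibre_product (opposite H) P sP) (right_fibre_product H P sP)
     prod.swap prod.swap"
  unfolding homeomorphic_maps_def left_fibre_product_def right_fibre_product_def prod.swap_def
  by (auto simp: continuous_map_in_subtopology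
      intro!: continuous_map_pairedI continuous_map_from_subtopology continuous_map_fst continuous_map_snd)

lemma topological_groupoid_opposite:
  assumes "topological_groupoid G"
  shows "topological_groupoid (opposite G)"
proof -
  have "continuous_map (composable (opposite G)) (composable G) prod.swap"
    unfolding composable_def prod.swap_def
    by (auto simp: continuous_map_in_subtopology
        intro!: continuous_map_pairedI continuous_map_from_subtopology continuous_map_fst continuous_map_snd)
  moreover have "continuous_map (composable G) (arrows G) (\<lambda>(x, y). mul G x y)"
    using assms by (simp add: topological_groupoid_def)
  ultimately have "continuous_map (composable (opposite G)) (arrows G) ((\<lambda>(x, y). mul G x y) \<circ> prod.swap)"
    by (rule continuous_map_compose)
  then show ?thesis
    using assms by (simp add: topological_groupoid_def algebraic_groupoid_opposite o_def case_prod_unfold)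
qed

section \<open>Actions and equivalences of opposite groupoids\<close>

lemma left_action_opposite:
  assumes "algebraic_groupoid H" "right_action H P sP act"
  shows "left_action (opposite H) P sP (\<lambda>h p. act p h)"
proof -
  have "continuous_map (left_fibre_product (opposite H) P sP) P ((\<lambda>(p, h). act p h) \<circ> prod.swap)"
    using homeomorphic_maps_swap_fibre_product assms(2)
    unfolding homeomorphic_maps_def right_action_def by (blast intro: continuous_map_compose)
  then show ?thesis
    using assms by (simp add: left_action_def right_action_def units_opposite o_def case_prod_unfold)
qed

lemma right_action_opposite:
  assumes "algebraic_groupoid G" "left_action G P rP act"
  shows "right_action (opposite G) P rP (\<lambda>p g. act g p)"
proof -
  have "continuous_map (right_fibre_product (opposite G) P rP) P ((\<lambda>(g, p). act g p) \<circ> prod.swap)"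
    using homeomorphic_maps_swap_fibre_product[of "opposite G" P rP] assms(2)
    unfolding homeomorphic_maps_def left_action_def opposite_opposite
    by (blast intro: continuous_map_compose)
  then show ?thesis
    using assms by (simp add: left_action_def right_action_def units_opposite o_def case_prod_unfold)
qed

lemma proper_left_action_opposite:
  assumes "proper_right_action H P sP act"
  shows "proper_left_action (opposite H) P sP (\<lambda>h p. act p h)"
  using compact_preimages_homeomorphic[OF homeomorphic_maps_swap_fibre_product
      assms[unfolded proper_right_action_def]]
  by (simp add: proper_left_action_def o_def case_prod_unfold)

lemma proper_right_action_opposite:
  assumes "proper_left_action G P rP act"
  shows "proper_right_action (opposite G) P rP (\<lambda>p g. act g p)"
proof -
  have "homeomorphic_maps (right_fibre_product (opposite G) P rP) (left_fibre_product G P rP)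
      prod.swap prod.swap"
    using homeomorphic_maps_swap_fibre_product[of "opposite G" P rP]
    unfolding opposite_opposite by (subst homeomorphic_maps_sym)
  from compact_preimages_homeomorphic[OF this assms[unfolded proper_left_action_def]]
  show ?thesis by (simp add: proper_right_action_def o_def case_prod_unfold)
qed

text \<open>The same space \<open>Z\<close> serves with its sides exchanged: (E1) and (E2) trade
  places, and so do (E4) and (E5). This symmetry reduces each "if and only if" to one
  implication.\<close>

lemma groupoid_equivalence_opposite:
  assumes G: "algebraic_groupoid G" and H: "algebraic_groupoid H"
    and E: "groupoid_equivalence G H Z rZ lact sZ ract"
  shows "groupoid_equivalence (opposite H) (opposite G) Z sZ (\<lambda>h z. ract z h) rZ (\<lambda>z g. lact g z)"
proof -
  have "left_orbit (opposite H) sZ (\<lambda>h z. ract z h) = right_orbit H sZ ract"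
    by (auto simp: fun_eq_iff left_orbit_def right_orbit_def)
  moreover have "right_orbit (opposite G) rZ (\<lambda>z g. lact g z) = left_orbit G rZ lact"
    by (auto simp: fun_eq_iff left_orbit_def right_orbit_def)
  moreover have "free_left_action (opposite H) Z sZ (\<lambda>h z. ract z h)"
    using E by (auto simp: groupoid_equivalence_def free_left_action_def free_right_action_def
        left_fibre_product_def right_fibre_product_def)
  moreover have "free_right_action (opposite G) Z rZ (\<lambda>z g. lact g z)"
    using E by (auto simp: groupoid_equivalence_def free_left_action_def free_right_action_def
        left_fibre_product_def right_fibre_product_def)
  moreover have "commuting_actions (opposite H) (opposite G) Z sZ (\<lambda>h z. ract z h) rZ (\<lambda>z g. lact g z)"
    using E by (auto simp: groupoid_equivalence_def commuting_actions_def)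
  moreover have "left_action (opposite H) Z sZ (\<lambda>h z. ract z h)"
    "right_action (opposite G) Z rZ (\<lambda>z g. lact g z)"
    "proper_left_action (opposite H) Z sZ (\<lambda>h z. ract z h)"
    "proper_right_action (opposite G) Z rZ (\<lambda>z g. lact g z)"
    using E G H by (simp_all add: groupoid_equivalence_def left_action_opposite right_action_opposite
        proper_left_action_opposite proper_right_action_opposite)
  ultimately show ?thesis
    using E by (simp add: groupoid_equivalence_def units_opposite G H)
qed

lemma proper_groupoid_opposite:
  assumes G: "topological_groupoid G" and proper: "proper_groupoid G"
  shows "proper_groupoid (opposite G)"
proof -
  have u: "units (opposite G) = units G"
    using G by (simp add: topological_groupoid_def units_opposite)
  have "compactin (arrows G) {g \<in> topspace (arrows G). (src G g, rng G g) \<in> K}"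
    if K: "compactin (prod_topology (units G) (units G)) K" for K
  proof -
    \<comment> \<open>Exchanging range and source composes the map into the product with the swap,
      so the preimage of \<open>K\<close> becomes that of the swapped set, which is again
      compact.\<close>
    have "continuous_map (prod_topology (units G) (units G)) (prod_topology (units G) (units G)) prod.swap"
      unfolding prod.swap_def by (intro continuous_map_pairedI continuous_map_fst continuous_map_snd)
    with K have "compactin (prod_topology (units G) (units G)) (prod.swap ` K)"
      by (rule image_compactin)
    then have "compactin (arrows G) {g \<in> topspace (arrows G). (rng G g, src G g) \<in> prod.swap ` K}"
      using proper unfolding proper_groupoid_iff[OF G] compact_preimages_def by blast
    then show ?thesis by simp
  qed
  then show ?thesis
    by (simp add: proper_groupoid_iff topological_groupoid_opposite G compact_preimages_def u)
qed

text \<open>The Cartan condition is symmetric in range and source, so the same neighbourhoods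
  work.\<close>

lemma Cartan_groupoid_opposite:
  assumes G: "topological_groupoid G" and "Cartan_groupoid G"
  shows "Cartan_groupoid (opposite G)"
proof -
  have "units (opposite G) = units G"
    using G by (simp add: topological_groupoid_def units_opposite)
  then show ?thesis
    using assms by (simp add: Cartan_groupoid_iff topological_groupoid_opposite conj_commute)
qed

section \<open>Transfer of compactness along an equivalence\<close>

text \<open>Since the unit space is Hausdorff, the fibre product is closed in the full product. It
  therefore meets \<open>A \<times> C\<close> in a compact set, which the action maps continuously
  into \<open>P\<close>.\<close>

lemma compactin_action_image:
  assumes G: "topological_groupoid G" and haus: "Hausdorff_space (arrows G)"
    and act: "left_action G P rP act"
    and A: "compactin (arrows G) A" and C: "compactin P C"
  shows "compactin P {act g p |g p. g \<in> A \<and> p \<in> C \<and> src G g = rP p}"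
proof -
  let ?X = "prod_topology (arrows G) P"
  have "continuous_map ?X (units G) (src G \<circ> fst)" "continuous_map ?X (units G) (rP \<circ> snd)"
    using continuous_map_rng_src(2)[OF G] act
    by (auto simp: left_action_def intro: continuous_map_compose continuous_map_fst continuous_map_snd)
  moreover have "Hausdorff_space (units G)"
    using haus by (simp add: units_def Hausdorff_space_subtopology)
  ultimately have cl: "closedin ?X {x \<in> topspace ?X. (src G \<circ> fst) x = (rP \<circ> snd) x}"
    by (intro closedin_continuous_maps_eq)
  let ?R = "{x \<in> topspace ?X. (src G \<circ> fst) x = (rP \<circ> snd) x} \<inter> A \<times> C"
  have "compactin ?X ?R"
    using cl A C by (intro closed_Int_compactin) (auto simp: compactin_Times)
  then have "compactin (left_fibre_product G P rP) ?R"
    by (auto simp: left_fibre_product_def compactin_subtopology)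
  then have "compactin P ((\<lambda>(g, p). act g p) ` ?R)"
    using act by (auto simp: left_action_def intro: image_compactin)
  moreover have "(\<lambda>(g, p). act g p) ` ?R = {act g p |g p. g \<in> A \<and> p \<in> C \<and> src G g = rP p}"
    using compactin_subset_topspace[OF A] compactin_subset_topspace[OF C] by force
  ultimately show ?thesis by simp
qed

text \<open>Once such a set of arrows is known to lie in a compact set, this closedness makes it
  compact.\<close>

lemma closedin_arrows_between:
  assumes G: "topological_groupoid G" and haus: "Hausdorff_space (arrows G)" and K: "compactin (units G) K"
  shows "closedin (arrows G) {g \<in> topspace (arrows G). rng G g \<in> K \<and> src G g \<in> K}"
proof -
  have "Hausdorff_space (units G)"
    using haus by (simp add: units_def Hausdorff_space_subtopology)
  then have "closedin (units G) K"
    using K by (rule compactin_imp_closedin)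
  then have "closedin (arrows G) ({g \<in> topspace (arrows G). rng G g \<in> K} \<inter> {g \<in> topspace (arrows G). src G g \<in> K})"
    using continuous_map_rng_src[OF G] by (intro closedin_Int closedin_continuous_map_preimage)
  then show ?thesis
    by (simp add: Collect_conj_eq Int_ac)
qed

lemma equivalence_source_surj:
  assumes "groupoid_equivalence G H Z rZ lact sZ ract"
  shows "sZ ` topspace Z = topspace (units H)"
proof -
  let ?q = "left_orbit G rZ lact"
  obtain f where f: "\<And>x. x \<in> topspace Z \<Longrightarrow> f (?q x) = sZ x"
    and hom: "homeomorphic_map (quotient_topology Z ?q) (units H) f"
    using assms by (auto simp: groupoid_equivalence_def induces_homeomorphism_def)
  have "f ` ?q ` topspace Z = topspace (units H)"
    using homeomorphic_imp_surjective_map[OF hom]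
      quotient_imp_surjective_map[OF quotient_map_quotient_topology] by metis
  then show ?thesis using f by (simp add: image_image)
qed

text \<open>By (E5) the map induced by \<open>sZ\<close> on the orbits of \<open>G\<close> is
  injective, so \<open>p\<close> and \<open>q\<close> have equal orbits; it remains to see that
  \<open>p\<close> lies in its own orbit.\<close>

lemma equivalence_source_fibre:
  assumes G: "algebraic_groupoid G" and E: "groupoid_equivalence G H Z rZ lact sZ ract"
    and p: "p \<in> topspace Z" and q: "q \<in> topspace Z" and eq: "sZ p = sZ q"
  obtains g where "g \<in> topspace (arrows G)" "src G g = rZ q" "p = lact g q"
proof -
  let ?q = "left_orbit G rZ lact"
  obtain f where f: "\<And>x. x \<in> topspace Z \<Longrightarrow> f (?q x) = sZ x"
    and hom: "homeomorphic_map (quotient_topology Z ?q) (units H) f"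
    using E by (auto simp: groupoid_equivalence_def induces_homeomorphism_def)
  have top: "topspace (quotient_topology Z ?q) = ?q ` topspace Z"
    using quotient_imp_surjective_map[OF quotient_map_quotient_topology] by metis
  have "?q p = ?q q"
  proof (rule inj_onD[OF homeomorphic_imp_injective_map[OF hom]])
    show "f (?q p) = f (?q q)"
      using eq by (simp only: f[OF p] f[OF q])
    show "?q p \<in> topspace (quotient_topology Z ?q)" "?q q \<in> topspace (quotient_topology Z ?q)"
      unfolding top using p q by blast+
  qed
  \<comment> \<open>The unit \<open>rZ p\<close> is its own source and fixes
    \<open>p\<close>.\<close>
  moreover have "p \<in> ?q p"
  proof -
    have act: "left_action G Z rZ lact"
      using E by (simp add: groupoid_equivalence_def)
    then have "rZ p \<in> topspace (units G)"
      using p by (auto simp: left_action_def continuous_map_def)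
    then have "rZ p \<in> topspace (arrows G)" "src G (rZ p) = rZ p"
      using G by (auto simp: units_def algebraic_groupoid_def Let_def)
    moreover have "lact (rZ p) p = p"
      using act p by (simp add: left_action_def)
    ultimately show ?thesis by (force simp: left_orbit_def)
  qed
  ultimately show thesis
    using that by (auto simp: left_orbit_def)
qed

text \<open>Compactness on the side of \<open>G\<close> is assumed for this one \<open>C\<close>
  only, so that the Cartan property, which controls only small sets, can supply it as well as
  properness.\<close>

lemma compactin_arrows_transfer:
  assumes G: "topological_groupoid G" "Hausdorff_space (arrows G)"
    and H: "topological_groupoid H" "Hausdorff_space (arrows H)"
    and E: "groupoid_equivalence G H Z rZ lact sZ ract"
    and C: "compactin Z C"
    and A: "compactin (arrows G) {g \<in> topspace (arrows G). rng G g \<in> rZ ` C \<and> src G g \<in> rZ ` C}"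
      (is "compactin _ ?A")
  shows "compactin (arrows H) {h \<in> topspace (arrows H). rng H h \<in> sZ ` C \<and> src H h \<in> sZ ` C}"
    (is "compactin _ ?B")
proof -
  have alg: "algebraic_groupoid G" using G by (simp add: topological_groupoid_def)
  have la: "left_action G Z rZ lact" and ra: "right_action H Z sZ ract"
    and proper: "proper_right_action H Z sZ ract"
    and comm: "commuting_actions G H Z rZ lact sZ ract"
    using E by (simp_all add: groupoid_equivalence_def)
  have CZ: "C \<subseteq> topspace Z" by (rule compactin_subset_topspace[OF C])
  let ?D = "{lact g p |g p. g \<in> ?A \<and> p \<in> C \<and> src G g = rZ p}"
  have D: "compactin Z ?D"
    by (rule compactin_action_image[OF G la A C])
  let ?F = "right_fibre_product H Z sZ"
  \<comment> \<open>The pairs \<open>(p, h)\<close> with \<open>p\<close> in \<open>C\<close> and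
    \<open>p\<close> moved by \<open>h\<close> into \<open>?D\<close>; properness of the right
    action makes this set compact, and its second projection will contain \<open>?B\<close>.\<close>
  let ?T = "{x \<in> topspace ?F. (\<lambda>(p, h). (ract p h, p)) x \<in> ?D \<times> C}"
  have "compactin (prod_topology Z Z) (?D \<times> C)"
    using D C by (simp add: compactin_Times)
  then have "compactin ?F ?T"
    using proper unfolding proper_right_action_def compact_preimages_def by blast
  moreover have "continuous_map ?F (arrows H) snd"
    unfolding right_fibre_product_def
    by (simp add: continuous_map_snd continuous_map_from_subtopology)
  ultimately have T: "compactin (arrows H) (snd ` ?T)"
    by (rule image_compactin)
  have "?B \<subseteq> snd ` ?T"
  proof
    fix h assume "h \<in> ?B"
    then obtain z w where h: "h \<in> topspace (arrows H)"
      and z: "z \<in> C" "sZ z = rng H h" and w: "w \<in> C" "sZ w = src H h"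
      by auto
    have zw: "z \<in> topspace Z" "w \<in> topspace Z" using z w CZ by auto
    have zhF: "(z, h) \<in> topspace ?F"
      using zw h z by (simp add: right_fibre_product_def)
    have zh: "ract z h \<in> topspace Z"
    proof -
      have "continuous_map ?F Z (\<lambda>(p, h). ract p h)"
        using ra by (simp add: right_action_def)
      from continuous_map_image_subset_topspace[OF this] zhF show ?thesis by auto
    qed
    have "sZ (ract z h) = sZ w"
      using ra zw h z w by (simp add: right_action_def)
    from equivalence_source_fibre[OF alg E zh zw(2) this]
    obtain g where g: "g \<in> topspace (arrows G)" "src G g = rZ w" "ract z h = lact g w" .
    have "rng G g = rZ (lact g w)"
      using la g zw by (simp add: left_action_def)
    also have "\<dots> = rZ z"
      using comm zw h z unfolding g(3)[symmetric] by (simp add: commuting_actions_def)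
    finally have "g \<in> ?A" using g z w by auto
    then have "ract z h \<in> ?D" using g w by auto
    then have "(z, h) \<in> ?T" using zhF z by simp
    then show "h \<in> snd ` ?T" by force
  qed
  moreover have "compactin (units H) (sZ ` C)"
    using C ra by (auto simp: right_action_def intro: image_compactin)
  ultimately show ?thesis
    using T closedin_arrows_between[OF H] by (blast intro: closed_compactin)
qed

section \<open>Transfer of properness and of the Cartan property\<close>

lemma proper_groupoid_transfer:
  assumes G: "topological_groupoid G" "Hausdorff_space (arrows G)"
    and H: "topological_groupoid H" "Hausdorff_space (arrows H)"
    and E: "groupoid_equivalence G H Z rZ lact sZ ract"
    and proper: "proper_groupoid G"
  shows "proper_groupoid H"
  unfolding proper_groupoid_iff[OF H(1)] compact_preimages_def
proof (intro allI impI)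
  fix K assume K: "compactin (prod_topology (units H) (units H)) K"
  \<comment> \<open>Uniting both projections lets a single compact \<open>C\<close> in
    \<open>Z\<close> cover the ranges and the sources.\<close>
  let ?K = "fst ` K \<union> snd ` K"
  have "compactin (units H) ?K"
    by (intro compactin_Un image_compactin[OF K] continuous_map_fst continuous_map_snd)
  moreover have "locally_compact_space Z" "open_map Z (units H) sZ"
    using E by (simp_all add: groupoid_equivalence_def)
  ultimately obtain C where C: "compactin Z C" "?K \<subseteq> sZ ` C"
    using compact_lift_open_map[OF _ _ equivalence_source_surj[OF E]] by blast
  have "compactin (units G) (rZ ` C)"
    using E C by (auto simp: groupoid_equivalence_def left_action_def intro: image_compactin)
  then have "compactin (prod_topology (units G) (units G)) (rZ ` C \<times> rZ ` C)"
    by (simp add: compactin_Times)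
  then have "compactin (arrows G) {g \<in> topspace (arrows G). (rng G g, src G g) \<in> rZ ` C \<times> rZ ` C}"
    using proper unfolding proper_groupoid_iff[OF G(1)] compact_preimages_def by blast
  then have B: "compactin (arrows H) {h \<in> topspace (arrows H). rng H h \<in> sZ ` C \<and> src H h \<in> sZ ` C}"
    using compactin_arrows_transfer[OF G H E C(1)] by simp
  have "Hausdorff_space (units H)"
    using H by (simp add: units_def Hausdorff_space_subtopology)
  then have "closedin (prod_topology (units H) (units H)) K"
    using K by (simp add: compactin_imp_closedin Hausdorff_space_prod_topology)
  moreover have "continuous_map (arrows H) (prod_topology (units H) (units H)) (\<lambda>h. (rng H h, src H h))"
    using continuous_map_rng_src[OF H(1)] by (intro continuous_map_pairedI)
  ultimately have "closedin (arrows H) {h \<in> topspace (arrows H). (rng H h, src H h) \<in> K}"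
    by (intro closedin_continuous_map_preimage)
  moreover have "{h \<in> topspace (arrows H). (rng H h, src H h) \<in> K} \<subseteq>
      {h \<in> topspace (arrows H). rng H h \<in> sZ ` C \<and> src H h \<in> sZ ` C}"
    using C(2) by force
  ultimately show "compactin (arrows H) {h \<in> topspace (arrows H). (rng H h, src H h) \<in> K}"
    using B by (blast intro: closed_compactin)
qed

lemma Cartan_groupoid_transfer:
  assumes G: "topological_groupoid G" "Hausdorff_space (arrows G)"
    and H: "topological_groupoid H" "Hausdorff_space (arrows H)"
    and E: "groupoid_equivalence G H Z rZ lact sZ ract"
    and Cartan: "Cartan_groupoid G"
  shows "Cartan_groupoid H"
  unfolding Cartan_groupoid_iff[OF H(1)]
proof
  have Z: "locally_compact_space Z" "Hausdorff_space Z" and op: "open_map Z (units H) sZ"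
    and rc: "continuous_map Z (units G) rZ" and sc: "continuous_map Z (units H) sZ"
    using E by (simp_all add: groupoid_equivalence_def left_action_def right_action_def)
  fix v assume "v \<in> topspace (units H)"
  then obtain z where z: "z \<in> topspace Z" "v = sZ z"
    using equivalence_source_surj[OF E] by blast
  then have "rZ z \<in> topspace (units G)"
    using rc by (auto simp: continuous_map_def)
  then obtain U K where U: "openin (units G) U" "rZ z \<in> U" "U \<subseteq> K"
    and A: "compactin (arrows G) {g \<in> topspace (arrows G). rng G g \<in> K \<and> src G g \<in> K}"
    using Cartan unfolding Cartan_groupoid_iff[OF G(1)] by blast
  have "openin Z {x \<in> topspace Z. rZ x \<in> U}"
    using rc U by (simp add: openin_continuous_map_preimage)
  moreover have "neighbourhood_base_of (compactin Z) Z"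
    using Z locally_compact_Hausdorff_imp_regular_space locally_compact_space_neighbourhood_base by blast
  moreover have "z \<in> {x \<in> topspace Z. rZ x \<in> U}"
    using z U by simp
  ultimately have "\<exists>V C. openin Z V \<and> compactin Z C \<and> z \<in> V \<and> V \<subseteq> C \<and> C \<subseteq> {x \<in> topspace Z. rZ x \<in> U}"
    unfolding neighbourhood_base_of by presburger
  then obtain V C where V: "openin Z V" "z \<in> V" "V \<subseteq> C" and C: "compactin Z C"
    and CU: "C \<subseteq> {x \<in> topspace Z. rZ x \<in> U}"
    by (elim exE conjE)
  have "compactin (units G) (rZ ` C)"
    by (rule image_compactin[OF C rc])
  then have "closedin (arrows G) {g \<in> topspace (arrows G). rng G g \<in> rZ ` C \<and> src G g \<in> rZ ` C}"
    by (rule closedin_arrows_between[OF G])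
  moreover have "{g \<in> topspace (arrows G). rng G g \<in> rZ ` C \<and> src G g \<in> rZ ` C} \<subseteq>
      {g \<in> topspace (arrows G). rng G g \<in> K \<and> src G g \<in> K}"
    using CU U by auto
  ultimately have "compactin (arrows G) {g \<in> topspace (arrows G). rng G g \<in> rZ ` C \<and> src G g \<in> rZ ` C}"
    using A by (blast intro: closed_compactin)
  then have "compactin (arrows H) {h \<in> topspace (arrows H). rng H h \<in> sZ ` C \<and> src H h \<in> sZ ` C}"
    by (rule compactin_arrows_transfer[OF G H E C])
  moreover have "openin (units H) (sZ ` V)" "v \<in> sZ ` V" "sZ ` V \<subseteq> sZ ` C"
    using op V z by (auto simp: open_map_def)
  moreover have "compactin (units H) (sZ ` C)"
    by (rule image_compactin[OF C sc])
  ultimately show "\<exists>U K. openin (units H) U \<and> v \<in> U \<and> U \<subseteq> K \<and> compactin (units H) K \<and>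
      compactin (arrows H) {h \<in> topspace (arrows H). rng H h \<in> K \<and> src H h \<in> K}"
    by blast
qed

theorem theorem2p2:
  fixes G :: "'a groupoid" and H :: "'b groupoid"
  assumes "locally_compact_Hausdorff_groupoid G" and "open_range_source G"
    and "locally_compact_Hausdorff_groupoid H" and "open_range_source H"
    and "equivalent_groupoids TYPE('z) G H"
  shows "(proper_groupoid G \<longleftrightarrow> proper_groupoid H) \<and> (Cartan_groupoid G \<longleftrightarrow> Cartan_groupoid H)"
proof -
  obtain Z :: "'z topology" and rZ lact sZ ract where E: "groupoid_equivalence G H Z rZ lact sZ ract"
    using assms(5) by (auto simp: equivalent_groupoids_def)
  have G: "topological_groupoid G" "Hausdorff_space (arrows G)"
    and H: "topological_groupoid H" "Hausdorff_space (arrows H)"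
    using assms by (simp_all add: locally_compact_Hausdorff_groupoid_def)
  have G': "topological_groupoid (opposite G)" "Hausdorff_space (arrows (opposite G))"
    and H': "topological_groupoid (opposite H)" "Hausdorff_space (arrows (opposite H))"
    using G H by (simp_all add: topological_groupoid_opposite)
  have E': "groupoid_equivalence (opposite H) (opposite G) Z sZ (\<lambda>h z. ract z h) rZ (\<lambda>z g. lact g z)"
    using G H E by (simp add: groupoid_equivalence_opposite topological_groupoid_def)
  \<comment> \<open>The property passes from \<open>H\<close> to its opposite, along
    \<open>E'\<close> to the opposite of \<open>G\<close>, and back to \<open>G\<close> as the
    opposite of its opposite.\<close>
  have "proper_groupoid G" if "proper_groupoid H"
    using proper_groupoid_opposite[OF G'(1)]
      proper_groupoid_transfer[OF H' G' E' proper_groupoid_opposite[OF H(1) that]] by simp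
  moreover have "Cartan_groupoid G" if "Cartan_groupoid H"
    using Cartan_groupoid_opposite[OF G'(1)]
      Cartan_groupoid_transfer[OF H' G' E' Cartan_groupoid_opposite[OF H(1) that]] by simp
  ultimately show ?thesis
    using proper_groupoid_transfer[OF G H E] Cartan_groupoid_transfer[OF G H E] by blast
qed

end
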